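(* Let $\boldsymbol f\in\mathbb R^{NM}$, $\tau\ge0$, let $p\ge1$ and let $q$ be its conjugate exponent ($\frac1p+\frac1q=1$), and let $\mathcal C\subseteq\mathbb R^{NM}$ be a nonempty closed convex set with orthogonal projection $P_{\mathcal C}$. Let $\widehat{\boldsymbol J_K}:\mathbb R^{NM}\to\mathcal X=\mathbb R^{N\times LM\times2}$ be the weighted patch-based Jacobian with adjoint $\widehat{\boldsymbol J_K}^{*}$, let $B_{\infty,q}=\{\boldsymbol\Phi\in\mathcal X:\|\boldsymbol\Phi(n)\|_{\mathcal S_q}\le1,\ n=1,\dots,N\}$, and put $$H(\boldsymbol u,\boldsymbol\Phi)=\tfrac12\|\boldsymbol u-\boldsymbol f\|_2^2+\tau\langle\widehat{\boldsymbol J_K}^{*}\boldsymbol\Phi,\boldsymbol u\rangle_2 .$$ Then the primal problem $\min_{\boldsymbol u\in\mathcal C}\frac12\|\boldsymbol u-\boldsymbol f\|_2^2+\tau\sum_{i=1}^N\|(\widehat{\boldsymbol J_K}\boldsymbol u)(i)\|_{\mathcal S_p}$ equals $\min_{\boldsymbol u\in\mathcal C}\max_{\boldsymbol\Phi\in B_{\infty,q}}H(\boldsymbol u,\boldsymbol\Phi)$, and there is a saddle point $(\hat{\boldsymbol u},\hat{\boldsymbol\Phi})\in\mathcal C\times B_{\infty,q}$ with $$\min_{\boldsymbol u\in\mathcal C}\max_{\boldsymbol\Phi\in B_{\infty,q}}H(\boldsymbol u,\boldsymbol\Phi)=H(\hat{\boldsymbol u},\hat{\boldsymbol\Phi})=\max_{\boldsymbol\Phi\in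 B_{\infty,q}}\min_{\boldsymbol u\in\mathcal C}H(\boldsymbol u,\boldsymbol\Phi).$$ Moreover, the dual objective $d(\boldsymbol\Phi)=\min_{\boldsymbol u\in\mathcal C}H(\boldsymbol u,\boldsymbol\Phi)$ is given by $$d(\boldsymbol\Phi)=\tfrac12\|\boldsymbol s-P_{\mathcal C}(\boldsymbol s)\|_2^2+\tfrac12\|\boldsymbol f\|_2^2-\tfrac12\|\boldsymbol s\|_2^2,\qquad\boldsymbol s=\boldsymbol f-\tau\widehat{\boldsymbol J_K}^{*}\boldsymbol\Phi,$$ and if $\hat{\boldsymbol\Phi}$ maximizes $d$ over $B_{\infty,q}$, then $\hat{\boldsymbol u}=P_{\mathcal C}(\boldsymbol f-\tau\widehat{\boldsymbol J_K}^{*}\hat{\boldsymbol\Phi})$ is the minimizer of the primal problem.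
   Context: Images: $\boldsymbol u=(\boldsymbol u_1,\dots,\boldsymbol u_M)\in\mathbb R^{NM}$ is an image with $M$ channels, each channel $\boldsymbol u_m\in\mathbb R^N$ being a function on a rectangular pixel grid with $N$ pixels $x_1,\dots,x_N\in\mathbb Z^2$. $\nabla\boldsymbol u_m=(\nabla_x\boldsymbol u_m,\nabla_y\boldsymbol u_m)$ is the discrete gradient, obtained by forward differences with step $1$ in the two axis directions, a difference being set to $0$ when the forward neighbour is outside the grid; thus $\nabla\boldsymbol u_m(i)\in\mathbb R^2$. Weights: $\mathcal W$ acts on vector fields on the grid by pointwise multiplication by the diagonal matrix $\operatorname{diag}(\boldsymbol w_1,\boldsymbol w_2)$, where $\boldsymbol w_1=\frac{1}{1+\kappa|\boldsymbol G_{\hat\sigma}*\nabla_x\boldsymbol f|}$ and $\boldsymbol w_2=\frac{1}{1+\kappa|\boldsymbol G_{\hat\sigma}*\nabla_y\boldsymbol f|}$ (evaluated pixelwise; for several channels, on channel $m$ with $\boldsymbol f_m$ in place of $\boldsymbol f$). Here $\kappa\ge0$ and $\hat\sigma>0$ are parameters and $\boldsymbol G_{\hat\sigma}*$ is Gaussian convolution of variance $\hat\sigma$. $\boldsymbol f$ is fixed, so $\mathcal W$ is a fixed linear operator. Weighted translations: $K$ is a Gaussian convolution kernel on $\{-L_K,\dots,L_K\}^2$ (positive, invariant under sign change of each coordinate, entries summing to $1$), $L=(2L_K+1)^2$, and $g_1,\dots,g_L$ enumerate $\{-L_K,\dots,L_K\}^2$. For a vector field $v$ on the grid, $(\Psi_l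 v)(i)=\sqrt{K[g_l]}\,v(x_i-g_l)$, $l=1,\dots,L$, where values of $v$ at points outside the grid are assigned by one fixed standard boundary convention (zero extension, periodic extension, or half-sample symmetric reflection). Weighted patch-based Jacobian: $\widehat{\boldsymbol J_K}:\mathbb R^{NM}\to\mathcal X=\mathbb R^{N\times LM\times 2}$ is the linear map such that for each pixel $i$, $(\widehat{\boldsymbol J_K}\boldsymbol u)(i)\in\mathbb R^{LM\times2}$ is the matrix whose row with index $h=(m-1)L+l$ is $(\Psi_l\mathcal W\nabla\boldsymbol u_m)(i)$, $1\le m\le M$, $1\le l\le L$. Norms: elements $\boldsymbol\Phi\in\mathcal X$ consist of $N$ submatrices $\boldsymbol\Phi(n)\in\mathbb R^{LM\times2}$; $\langle\boldsymbol\Lambda,\boldsymbol\Upsilon\rangle_{\mathcal X}=\sum_{n=1}^N\operatorname{trace}(\boldsymbol\Upsilon(n)^T\boldsymbol\Lambda(n))$. $\|\cdot\|_{\mathcal S_r}$ is the Schatten norm of order $r$ ($\ell_r$ norm of the singular values). The adjoint $\widehat{\boldsymbol J_K}^{*}:\mathcal X\to\mathbb R^{NM}$ is taken with respect to $\langle\cdot,\cdot\rangle_{\mathcal X}$ and the Euclidean inner product $\langle\cdot,\cdot\rangle_2$ on $\mathbb R^{NM}$. *)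

theory Defs
  imports "HOL-Analysis.Analysis"
begin

section \<open>Pixel grid, gradient and boundary conventions\<close>

text \<open>
  The pixels are enumerated by a finite type \<open>'n\<close> (so \<open>N = CARD('n)\<close>) through a bijection \<open>px\<close> from
  \<open>'n\<close> onto a rectangle of integer points; \<open>inv px p\<close> is the pixel located at the grid point \<open>p\<close>.
  A single channel is an element of \<open>real ^ 'n\<close>, a vector field on the grid an element of
  \<open>real ^ 2 ^ 'n\<close>, and an image with \<open>M = CARD('m)\<close> channels an element of \<open>real ^ 'n ^ 'm\<close>.
\<close>

definition grid :: "int \<times> int \<Rightarrow> int \<times> int \<Rightarrow> (int \<times> int) set" where
  "grid lo hi = {fst lo..fst hi} \<times> {snd lo..snd hi}"

definition window :: "nat \<Rightarrow> (int \<times> int) set" where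
  "window R = {- int R..int R} \<times> {- int R..int R}"

definition fwd_diff ::
  "int \<times> int \<Rightarrow> int \<times> int \<Rightarrow> ('n::finite \<Rightarrow> int \<times> int) \<Rightarrow> int \<times> int \<Rightarrow> real ^ 'n \<Rightarrow> real ^ 'n" where
  "fwd_diff lo hi px e u =
     (\<chi> i. if px i + e \<in> grid lo hi then u $ inv px (px i + e) - u $ i else 0)"

definition grad_x ::
  "int \<times> int \<Rightarrow> int \<times> int \<Rightarrow> ('n::finite \<Rightarrow> int \<times> int) \<Rightarrow> real ^ 'n \<Rightarrow> real ^ 'n" where
  "grad_x lo hi px u = fwd_diff lo hi px (1, 0) u"

definition grad_y ::
  "int \<times> int \<Rightarrow> int \<times> int \<Rightarrow> ('n::finite \<Rightarrow> int \<times> int) \<Rightarrow> real ^ 'n \<Rightarrow> real ^ 'n" where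
  "grad_y lo hi px u = fwd_diff lo hi px (0, 1) u"

definition grad ::
  "int \<times> int \<Rightarrow> int \<times> int \<Rightarrow> ('n::finite \<Rightarrow> int \<times> int) \<Rightarrow> real ^ 'n \<Rightarrow> real ^ 2 ^ 'n" where
  "grad lo hi px u = (\<chi> i. vector [grad_x lo hi px u $ i, grad_y lo hi px u $ i])"

datatype boundary = Zero_Ext | Periodic_Ext | Symmetric_Ext

definition wrap :: "int \<Rightarrow> int \<Rightarrow> int \<Rightarrow> int" where
  "wrap a b z = a + (z - a) mod (b - a + 1)"

text \<open>Half-sample symmetric reflection \<open>\<dots>, a+1, a | a, a+1, \<dots>, b | b, b-1, \<dots>\<close>, of period
  \<open>2 * (b - a + 1)\<close>.\<close>

definition reflect :: "int \<Rightarrow> int \<Rightarrow> int \<Rightarrow> int" where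
  "reflect a b z =
     (let k = b - a + 1; r = (z - a) mod (2 * k) in a + (if r < k then r else 2 * k - 1 - r))"

fun extend ::
  "boundary \<Rightarrow> int \<times> int \<Rightarrow> int \<times> int \<Rightarrow> ('n::finite \<Rightarrow> int \<times> int) \<Rightarrow> 'b::zero ^ 'n \<Rightarrow> int \<times> int \<Rightarrow> 'b" where
  "extend Zero_Ext lo hi px v p = (if p \<in> grid lo hi then v $ inv px p else 0)"
| "extend Periodic_Ext lo hi px v p =
     v $ inv px (wrap (fst lo) (fst hi) (fst p), wrap (snd lo) (snd hi) (snd p))"
| "extend Symmetric_Ext lo hi px v p =
     v $ inv px (reflect (fst lo) (fst hi) (fst p), reflect (snd lo) (snd hi) (snd p))"


section \<open>Gaussian kernels and weights\<close>

definition gauss :: "real \<Rightarrow> int \<times> int \<Rightarrow> real" where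
  "gauss s z = exp (- ((real_of_int (fst z))\<^sup>2 + (real_of_int (snd z))\<^sup>2) / (2 * s))"

text \<open>The Gaussian of variance \<open>s\<close> sampled on the integer points of \<open>D\<close> and normalised to total
  mass \<open>1\<close> there; \<open>D\<close> is a window \<open>{-R..R} \<times> {-R..R}\<close> (truncated kernel) or the whole plane.\<close>

definition gauss_kernel :: "(int \<times> int) set \<Rightarrow> real \<Rightarrow> int \<times> int \<Rightarrow> real" where
  "gauss_kernel D s z = gauss s z / infsum (gauss s) D"

text \<open>The normalising sum converges, also over the whole plane, so \<open>infsum\<close> does not take its default
  value \<open>0\<close>.\<close>

lemma gauss_summable:
  assumes "0 < s" shows "gauss s summable_on D"
proof -
  define h :: "int \<Rightarrow> real" where "h k = exp (- ((real_of_int k)\<^sup>2) / (2 * s))" for k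
  have h_nonneg: "0 \<le> h k" for k by (simp add: h_def)
  have nat: "(\<lambda>n. h (int n)) summable_on UNIV"
  proof (rule norm_summable_imp_summable_on, rule summable_comparison_test')
    show "summable (\<lambda>n. exp (- 1 / (2 * s)) ^ n)"
      using assms by (intro summable_geometric) simp
    fix n :: nat
    have "real n \<le> (real n)\<^sup>2"
      by (cases n) (auto simp: power2_eq_square)
    then have "h (int n) \<le> exp (- real n / (2 * s))"
      using assms by (simp add: h_def divide_right_mono)
    also have "\<dots> = exp (- 1 / (2 * s)) ^ n"
      by (simp add: exp_of_nat_mult[symmetric])
    finally show "norm (norm (h (int n))) \<le> exp (- 1 / (2 * s)) ^ n"
      by (simp add: h_def)
  qed
  have "h summable_on range int"
    using nat by (subst summable_on_reindex) (auto simp: o_def)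
  moreover have "h summable_on range (\<lambda>n. - int n)"
    using nat by (subst summable_on_reindex) (auto simp: o_def h_def inj_on_def)
  ultimately have "h summable_on (range int \<union> range (\<lambda>n. - int n))"
    by (rule summable_on_union)
  moreover have "range int \<union> range (\<lambda>n. - int n) = UNIV"
    by (auto) (metis int_cases2 rangeI)
  ultimately have h: "(\<lambda>k. norm (h k)) summable_on UNIV"
    by (simp add: h_nonneg)
  have "(\<lambda>z. norm (case z of (x, y) \<Rightarrow> h x * h y)) summable_on UNIV \<times> UNIV"
    using abs_summable_on_product[OF _ _ h[unfolded abs_summable_equivalent] h[unfolded abs_summable_equivalent]]
    unfolding abs_summable_equivalent by simp
  then have "(\<lambda>(x, y). h x * h y) summable_on UNIV \<times> UNIV"
    by (rule summable_on_cong[THEN iffD1, rotated]) (auto simp: h_nonneg)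
  moreover have "gauss s = (\<lambda>(x, y). h x * h y)"
    by (auto simp: gauss_def h_def fun_eq_iff exp_add[symmetric] add_divide_distrib diff_divide_distrib)
  ultimately have "gauss s summable_on UNIV" by simp
  then show ?thesis by (rule summable_on_subset_banach) auto
qed

lemma gauss_kernel_window:
  "0 < gauss_kernel (window R) s z"
  "gauss_kernel (window R) s (- a, b) = gauss_kernel (window R) s (a, b)"
  "gauss_kernel (window R) s (a, - b) = gauss_kernel (window R) s (a, b)"
  "(\<Sum>z\<in>window R. gauss_kernel (window R) s z) = 1"
proof -
  have fin: "finite (window R)" by (simp add: window_def)
  have ne: "window R \<noteq> {}" by (auto simp: window_def)
  have "0 < sum (gauss s) (window R)" using fin ne by (intro sum_pos) (auto simp: gauss_def)
  then show "0 < gauss_kernel (window R) s z" "(\<Sum>z\<in>window R. gauss_kernel (window R) s z) = 1"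
    using fin by (auto simp: gauss_kernel_def gauss_def sum_divide_distrib[symmetric])
qed (simp_all add: gauss_kernel_def gauss_def)

definition gauss_conv ::
  "boundary \<Rightarrow> (int \<times> int) set \<Rightarrow> real \<Rightarrow> int \<times> int \<Rightarrow> int \<times> int \<Rightarrow> ('n::finite \<Rightarrow> int \<times> int) \<Rightarrow>
     real ^ 'n \<Rightarrow> real ^ 'n" where
  "gauss_conv bc D s lo hi px v =
     (\<chi> i. infsum (\<lambda>z. gauss_kernel D s z * extend bc lo hi px v (px i - z)) D)"

definition edge_weight :: "real \<Rightarrow> real ^ 'n \<Rightarrow> real ^ 'n" where
  "edge_weight \<kappa> h = (\<chi> i. 1 / (1 + \<kappa> * \<bar>h $ i\<bar>))"

definition weight_op :: "real ^ 'n \<Rightarrow> real ^ 'n \<Rightarrow> real ^ 2 ^ 'n \<Rightarrow> real ^ 2 ^ 'n" where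
  "weight_op w1 w2 v = (\<chi> i. vector [w1 $ i * v $ i $ 1, w2 $ i * v $ i $ 2])"

text \<open>The action of the operator \<open>W\<close> on a vector field belonging to a channel whose data are \<open>fm\<close>.\<close>

definition edge_weight_op ::
  "boundary \<Rightarrow> (int \<times> int) set \<Rightarrow> real \<Rightarrow> real \<Rightarrow> int \<times> int \<Rightarrow> int \<times> int \<Rightarrow> ('n::finite \<Rightarrow> int \<times> int) \<Rightarrow>
     real ^ 'n \<Rightarrow> real ^ 2 ^ 'n \<Rightarrow> real ^ 2 ^ 'n" where
  "edge_weight_op bc D \<sigma> \<kappa> lo hi px fm v =
     weight_op (edge_weight \<kappa> (gauss_conv bc D \<sigma> lo hi px (grad_x lo hi px fm)))
               (edge_weight \<kappa> (gauss_conv bc D \<sigma> lo hi px (grad_y lo hi px fm))) v"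


section \<open>The weighted patch-based Jacobian\<close>

definition weighted_shift ::
  "boundary \<Rightarrow> (int \<times> int \<Rightarrow> real) \<Rightarrow> int \<times> int \<Rightarrow> int \<times> int \<Rightarrow> ('n::finite \<Rightarrow> int \<times> int) \<Rightarrow> int \<times> int \<Rightarrow>
     real ^ 2 ^ 'n \<Rightarrow> real ^ 2 ^ 'n" where
  "weighted_shift bc K lo hi px g v =
     (\<chi> i. sqrt (K g) *\<^sub>R extend bc lo hi px v (px i - g))"

text \<open>
  \<open>W m\<close> is the weight operator of channel \<open>m\<close>, and \<open>g\<close> enumerates the shifts.  The row with number
  \<open>h = (m - 1) * L + l\<close> of the matrix at a pixel is indexed by the pair \<open>(m, l)\<close>; an element of
  \<open>real ^ 2 ^ ('m \<times> 'l) ^ 'n\<close> consists of \<open>N\<close> matrices with \<open>L * M\<close> rows and \<open>2\<close> columns.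
\<close>

definition patch_jacobian ::
  "boundary \<Rightarrow> (int \<times> int \<Rightarrow> real) \<Rightarrow> ('l::finite \<Rightarrow> int \<times> int) \<Rightarrow> ('m::finite \<Rightarrow> real ^ 2 ^ 'n \<Rightarrow> real ^ 2 ^ 'n) \<Rightarrow>
     int \<times> int \<Rightarrow> int \<times> int \<Rightarrow> ('n::finite \<Rightarrow> int \<times> int) \<Rightarrow>
     real ^ 'n ^ 'm \<Rightarrow> real ^ 2 ^ ('m \<times> 'l) ^ 'n" where
  "patch_jacobian bc K g W lo hi px u =
     (\<chi> i. \<chi> h. case h of (m, l) \<Rightarrow>
        weighted_shift bc K lo hi px (g l) (W m (grad lo hi px (u $ m))) $ i)"

lemma extend_add:
  fixes v w :: "'b::monoid_add ^ 'n::finite"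
  shows "extend bc lo hi px (v + w) p = extend bc lo hi px v p + extend bc lo hi px w p"
  by (cases bc) auto

lemma extend_scaleR:
  fixes v :: "'b::real_vector ^ 'n::finite"
  shows "extend bc lo hi px (c *\<^sub>R v) p = c *\<^sub>R extend bc lo hi px v p"
  by (cases bc) auto

lemma linear_grad: "linear (grad lo hi px)"
  by (rule linearI)
     (simp_all add: grad_def grad_x_def grad_y_def fwd_diff_def vec_eq_iff forall_2 algebra_simps)

lemma linear_edge_weight_op: "linear (edge_weight_op bc D \<sigma> \<kappa> lo hi px fm)"
  by (rule linearI) (simp_all add: edge_weight_op_def weight_op_def vec_eq_iff forall_2 algebra_simps)

lemma linear_patch_jacobian:
  assumes "\<And>m. linear (W m)"
  shows "linear (patch_jacobian bc K g W lo hi px)"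
  by (rule linearI)
     (simp_all add: patch_jacobian_def weighted_shift_def vec_eq_iff extend_add extend_scaleR
       linear_add[OF linear_grad] linear_cmul[OF linear_grad] linear_add[OF assms]
       linear_cmul[OF assms] algebra_simps split: prod.split)

text \<open>The inner product of the type of matrix fields, hence the one used by \<open>adjoint\<close>, is the trace
  inner product.\<close>

lemma inner_matrix_field_eq_trace:
  fixes A B :: "real ^ 'c ^ 'r ^ 'n"
  shows "A \<bullet> B = (\<Sum>n\<in>UNIV. trace (transpose (B $ n) ** (A $ n)))"
proof -
  have "(A $ n) \<bullet> (B $ n) = trace (transpose (B $ n) ** (A $ n))" for n
    by (simp add: inner_vec_def trace_def matrix_matrix_mult_def transpose_def mult.commute)
       (rule sum.swap)
  then show ?thesis
    by (simp add: inner_vec_def [of A B])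
qed


section \<open>Schatten norms\<close>

text \<open>Singular values are the nonnegative square roots of the eigenvalues of \<open>A\<^sup>T A\<close>, counted with
  the dimension of the eigenspace.  The possible value \<open>0\<close> does not contribute to the norms.\<close>

definition sv_mult :: "real ^ 'c ^ 'r \<Rightarrow> real \<Rightarrow> nat" where
  "sv_mult A \<sigma> = dim {v. (transpose A ** A) *v v = \<sigma>\<^sup>2 *\<^sub>R v}"

definition singular_values :: "real ^ 'c ^ 'r \<Rightarrow> real set" where
  "singular_values A = {\<sigma>. 0 \<le> \<sigma> \<and> (\<exists>v. v \<noteq> 0 \<and> (transpose A ** A) *v v = \<sigma>\<^sup>2 *\<^sub>R v)}"

definition schatten_norm :: "ennreal \<Rightarrow> real ^ 'c ^ 'r \<Rightarrow> real" where
  "schatten_norm r A =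
     (if r = \<infinity> then Max (singular_values A)
      else (\<Sum>\<sigma>\<in>singular_values A. real (sv_mult A \<sigma>) * \<sigma> powr enn2real r) powr (1 / enn2real r))"

definition dual_ball :: "ennreal \<Rightarrow> (real ^ 'c ^ 'r ^ 'n) set" where
  "dual_ball q = {\<Phi>. \<forall>n. schatten_norm q (\<Phi> $ n) \<le> 1}"


section \<open>Primal, saddle-point and dual objectives\<close>

definition primal_objective ::
  "ennreal \<Rightarrow> real \<Rightarrow> 'u::real_normed_vector \<Rightarrow> ('u \<Rightarrow> real ^ 'c ^ 'r ^ 'n) \<Rightarrow> 'u \<Rightarrow> real" where
  "primal_objective p \<tau> f J u =
     1 / 2 * (norm (u - f))\<^sup>2 + \<tau> * (\<Sum>i\<in>UNIV. schatten_norm p (J u $ i))"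

definition saddle_objective ::
  "real \<Rightarrow> 'u::real_inner \<Rightarrow> ('u \<Rightarrow> 'x::real_inner) \<Rightarrow> 'u \<Rightarrow> 'x \<Rightarrow> real" where
  "saddle_objective \<tau> f J u \<Phi> = 1 / 2 * (norm (u - f))\<^sup>2 + \<tau> * (adjoint J \<Phi> \<bullet> u)"

end

theory Submission
  imports Defs
begin

text \<open>
  Two facts carry the theorem.

  The first is the duality of Schatten norms: for conjugate \<open>p\<close> and \<open>q\<close> the number
  \<open>schatten_norm p X\<close> is the maximum of \<open>X \<bullet> Y\<close> over the matrices \<open>Y\<close> with
  \<open>schatten_norm q Y \<le> 1\<close> (\<open>schatten_Hoelder\<close>, \<open>schatten_norm_attained\<close>).  Summed over the
  pixels it turns the regulariser into the support function of \<open>dual_ball q\<close>, so that maximising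
  \<open>H u\<close> over the ball gives the primal objective.  Used in both directions it also exhibits the ball
  as an intersection of closed half-spaces, hence convex and closed; it is bounded as well, hence
  compact (\<open>dual_ball_compact_convex\<close>).
  Everything about a matrix \<open>A\<close> is read off from an orthonormal basis \<open>v\<close> whose images \<open>A *v v j\<close>
  are pairwise orthogonal: their norms are the singular values with multiplicity
  (\<open>schatten_norm_svd_basis\<close>).  For two columns such a basis is found by rotating a frame through a
  right angle, since \<open>(A *v v 1) \<bullet> (A *v v 2)\<close> changes its sign on the way.

  The second is that \<open>H\<close> is strongly convex in \<open>u\<close> and affine in \<open>\<Phi>\<close>.  Completing the square,
  \<open>H u \<Phi>\<close> is half the squared distance from \<open>u\<close> to \<open>s = f - \<tau> J\<^sup>* \<Phi>\<close> plus a term in \<open>\<Phi>\<close> alone, so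
  its unique minimiser over \<open>C\<close> is the projection of \<open>s\<close>, which depends continuously on \<open>\<Phi>\<close>, and
  the formula for the dual objective follows.  The dual objective is continuous and has a maximiser
  \<open>\<Phi>\<close> on the compact ball.  Moving from \<open>\<Phi>\<close> a little towards another point of the ball and letting
  the step tend to zero shows that \<open>\<Phi>\<close> and its projection form a saddle point (\<open>saddle_point\<close>).
  Any primal minimiser minimises \<open>H\<close> at this \<open>\<Phi>\<close>, hence is
  the projection (\<open>primal_minimizer_iff\<close>).
\<close>

section \<open>Hoelder duality for finite families of numbers\<close>

text \<open>
  The same shape as \<open>schatten_norm\<close>, with a family of singular values listed with repetitions in
  place of a set with multiplicities.
\<close>

definition lp_norm :: "ennreal \<Rightarrow> ('c::finite \<Rightarrow> real) \<Rightarrow> real" where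
  "lp_norm r a =
     (if r = \<infinity> then Max (range a) else (\<Sum>j\<in>UNIV. a j powr enn2real r) powr (1 / enn2real r))"

lemma conjugate_exponents_cases:
  fixes p q :: ennreal
  assumes "1 / p + 1 / q = 1"
  obtains (one_top) "p = 1" "q = \<infinity>" | (top_one) "p = \<infinity>" "q = 1"
    | (real) "p \<noteq> \<infinity>" "q \<noteq> \<infinity>" "1 < enn2real p" "1 < enn2real q" "1 / enn2real p + 1 / enn2real q = 1"
proof (cases p; cases q)
  fix x y :: real
  assume xy: "p = ennreal x" "0 \<le> x" "q = ennreal y" "0 \<le> y"
  have pos: "0 < x" "0 < y"
    using assms xy by (auto simp: less_le)
  have "ennreal (1 / x + 1 / y) = 1"
    using assms xy pos by (simp add: divide_ennreal less_imp_le flip: ennreal_1 ennreal_plus)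
  then have eq: "1 / x + 1 / y = 1" using pos by (simp only: ennreal_eq_1)
  have "1 / x < 1" "1 / y < 1"
    using eq pos by (smt (verit) zero_less_divide_1_iff)+
  then have "1 < x" "1 < y" using pos by simp_all
  then show thesis using real eq xy by simp
next
  fix x :: real
  assume x: "p = ennreal x" "0 \<le> x" and q: "q = top"
  have "ennreal 1 / ennreal x = ennreal 1" "0 < x"
    using assms x q by (auto simp: less_le)
  then have "ennreal (1 / x) = ennreal 1" using x by (simp only: divide_ennreal)
  then have "x = 1" using \<open>0 < x\<close> by (simp add: ennreal_eq_1)
  then show thesis using one_top x q by simp
next
  fix y :: real
  assume p: "p = top" and y: "q = ennreal y" "0 \<le> y"
  have "ennreal 1 / ennreal y = ennreal 1" "0 < y"
    using assms y p by (auto simp: less_le)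
  then have "ennreal (1 / y) = ennreal 1" using y by (simp only: divide_ennreal)
  then have "y = 1" using \<open>0 < y\<close> by (simp add: ennreal_eq_1)
  then show thesis using top_one y p by simp
qed (use assms in auto)

text \<open>
  A Hoelder inequality in which \<open>s\<close> and \<open>t\<close> are coupled by a doubly substochastic \<open>w\<close>.  This is what
  the trace pairing of two matrices with different singular bases needs.  After Young's inequality
  each term involves only \<open>j\<close> or only \<open>k\<close>, and \<open>w\<close> disappears through its row and column sums.
\<close>

lemma sum_mult_le_lp_norm:
  fixes s t :: "'c::finite \<Rightarrow> real" and w :: "'c \<Rightarrow> 'c \<Rightarrow> real"
  assumes pq: "1 / p + 1 / q = (1::ennreal)"
    and s: "\<And>j. 0 \<le> s j" and t: "\<And>k. 0 \<le> t k" and w: "\<And>j k. 0 \<le> w j k"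
    and row: "\<And>j. (\<Sum>k\<in>UNIV. w j k) \<le> 1" and col: "\<And>k. (\<Sum>j\<in>UNIV. w j k) \<le> 1"
    and t1: "lp_norm q t \<le> 1"
  shows "(\<Sum>j\<in>UNIV. \<Sum>k\<in>UNIV. w j k * (s j * t k)) \<le> lp_norm p s"
proof -
  have rowsum: "(\<Sum>j\<in>UNIV. \<Sum>k\<in>UNIV. w j k * a j) \<le> (\<Sum>j\<in>UNIV. a j)"
    if "\<And>j. 0 \<le> a j" for a :: "'c \<Rightarrow> real"
    unfolding sum_distrib_right[symmetric] using row that
    by (intro sum_mono mult_left_le_one_le sum_nonneg w) auto
  have colsum: "(\<Sum>j\<in>UNIV. \<Sum>k\<in>UNIV. w j k * b k) \<le> (\<Sum>k\<in>UNIV. b k)"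
    if "\<And>k. 0 \<le> b k" for b :: "'c \<Rightarrow> real"
  proof -
    have "(\<Sum>j\<in>UNIV. \<Sum>k\<in>UNIV. w j k * b k) = (\<Sum>k\<in>UNIV. (\<Sum>j\<in>UNIV. w j k) * b k)"
      by (subst sum.swap) (simp add: sum_distrib_right)
    also have "\<dots> \<le> (\<Sum>k\<in>UNIV. b k)"
      using col that by (intro sum_mono mult_left_le_one_le sum_nonneg w) auto
    finally show ?thesis .
  qed
  show ?thesis
    using pq
  proof (cases rule: conjugate_exponents_cases)
    case one_top
    then have "t k \<le> 1" for k using t1 by (simp add: lp_norm_def)
    then have "(\<Sum>j\<in>UNIV. \<Sum>k\<in>UNIV. w j k * (s j * t k)) \<le> (\<Sum>j\<in>UNIV. \<Sum>k\<in>UNIV. w j k * s j)"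
      by (intro sum_mono mult_left_mono w) (simp add: mult_left_le s)
    also have "\<dots> \<le> (\<Sum>j\<in>UNIV. s j)" by (rule rowsum[OF s])
    also have "\<dots> = lp_norm p s" using one_top s by (simp add: lp_norm_def sum_nonneg)
    finally show ?thesis .
  next
    case top_one
    define N where "N = lp_norm p s"
    have N: "s j \<le> N" for j using top_one by (simp add: lp_norm_def N_def)
    then have "0 \<le> N" using s order_trans by blast
    have "(\<Sum>j\<in>UNIV. \<Sum>k\<in>UNIV. w j k * (s j * t k)) \<le> (\<Sum>j\<in>UNIV. \<Sum>k\<in>UNIV. w j k * (N * t k))"
      by (intro sum_mono mult_left_mono mult_right_mono w N t)
    also have "\<dots> \<le> (\<Sum>k\<in>UNIV. N * t k)" by (rule colsum) (simp add: \<open>0 \<le> N\<close> t)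
    also have "\<dots> = N * (\<Sum>k\<in>UNIV. t k)" by (simp add: sum_distrib_left)
    also have "\<dots> \<le> N" using t1 top_one t \<open>0 \<le> N\<close>
      by (intro mult_left_le) (auto simp: lp_norm_def sum_nonneg)
    finally show ?thesis by (simp add: N_def)
  next
    case real
    define P Q where "P = enn2real p" and "Q = enn2real q"
    have PQ: "1 < P" "1 < Q" "1 / P + 1 / Q = 1" using real by (simp_all add: P_def Q_def)
    define N where "N = lp_norm p s"
    have N: "N = (\<Sum>j\<in>UNIV. s j powr P) powr (1 / P)"
      using real by (simp add: N_def lp_norm_def P_def)
    have sumQ: "(\<Sum>k\<in>UNIV. t k powr Q) \<le> 1"
    proof -
      have "((\<Sum>k\<in>UNIV. t k powr Q) powr (1 / Q)) powr Q \<le> 1 powr Q"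
        using t1 real PQ by (intro powr_mono2) (auto simp: lp_norm_def Q_def)
      then show ?thesis using PQ by (simp add: powr_powr sum_nonneg)
    qed
    show ?thesis
    proof (cases "N = 0")
      case True
      then have "(\<Sum>j\<in>UNIV. s j powr P) = 0" by (simp add: N)
      then have "s j = 0" for j by (simp add: sum_nonneg_eq_0_iff)
      then show ?thesis using True by (simp add: N_def)
    next
      case False
      then have "0 < N" by (simp add: N)
      have NP: "N powr P = (\<Sum>j\<in>UNIV. s j powr P)"
        using PQ by (simp add: N powr_powr sum_nonneg)
      have "(\<Sum>j\<in>UNIV. \<Sum>k\<in>UNIV. w j k * (s j * t k)) / N
          = (\<Sum>j\<in>UNIV. \<Sum>k\<in>UNIV. w j k * (s j / N * t k))"
        by (simp add: sum_divide_distrib)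
      also have "\<dots> \<le> (\<Sum>j\<in>UNIV. \<Sum>k\<in>UNIV. w j k * ((s j / N) powr P / P + t k powr Q / Q))"
        using s t \<open>0 < N\<close> by (intro sum_mono mult_left_mono w Youngs_inequality PQ) auto
      also have "\<dots> = (\<Sum>j\<in>UNIV. \<Sum>k\<in>UNIV. w j k * ((s j / N) powr P / P))
          + (\<Sum>j\<in>UNIV. \<Sum>k\<in>UNIV. w j k * (t k powr Q / Q))"
        by (simp add: distrib_left sum.distrib)
      also have "\<dots> \<le> (\<Sum>j\<in>UNIV. (s j / N) powr P / P) + (\<Sum>k\<in>UNIV. t k powr Q / Q)"
        using PQ by (intro add_mono rowsum colsum) auto
      also have "\<dots> = (\<Sum>j\<in>UNIV. s j powr P) / N powr P / P + (\<Sum>k\<in>UNIV. t k powr Q) / Q"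
        using s \<open>0 < N\<close> by (simp add: powr_divide sum_divide_distrib)
      also have "\<dots> \<le> 1 / P + 1 / Q"
        using PQ sumQ \<open>0 < N\<close> NP by (intro add_mono divide_right_mono) auto
      finally show ?thesis using PQ \<open>0 < N\<close> by (simp add: N_def[symmetric] divide_simps)
    qed
  qed
qed

text \<open>
  The condition that \<open>c\<close> vanishes where \<open>s\<close> does lets \<open>c\<close> be prescribed as singular values along the
  normalised images of a singular basis, which exist only where \<open>s\<close> is nonzero.
\<close>

lemma lp_norm_attained:
  fixes s :: "'c::finite \<Rightarrow> real"
  assumes pq: "1 / p + 1 / q = (1::ennreal)" and s: "\<And>j. 0 \<le> s j"
  obtains c where "\<And>j. 0 \<le> c j" "\<And>j. s j = 0 \<Longrightarrow> c j = 0" "lp_norm q c \<le> 1"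
    "(\<Sum>j\<in>UNIV. s j * c j) = lp_norm p s"
  using pq
proof (cases rule: conjugate_exponents_cases)
  case one_top
  show ?thesis
    by (rule that[of "\<lambda>j. if s j = 0 then 0 else 1"])
       (use one_top s in \<open>auto simp: lp_norm_def sum_nonneg intro!: sum.cong simp del: if_image_distrib\<close>)
next
  case top_one
  have "Max (range s) \<in> range s" by (intro Max_in) auto
  then obtain j0 where "Max (range s) = s j0" by (rule rangeE)
  then have j0: "lp_norm p s = s j0" using top_one by (simp add: lp_norm_def)
  show ?thesis
  proof (rule that[of "\<lambda>j. if j = j0 \<and> s j \<noteq> 0 then 1 else 0"])
    show "lp_norm q (\<lambda>j. if j = j0 \<and> s j \<noteq> 0 then 1 else 0) \<le> 1"
      using top_one by (simp add: lp_norm_def if_distrib[of "\<lambda>x. x powr _"] sum.If_cases card_le_Suc0_iff_eq)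
    have "(\<Sum>j\<in>UNIV. s j * (if j = j0 \<and> s j \<noteq> 0 then 1 else 0)) = (\<Sum>j\<in>UNIV. if j = j0 then s j else 0)"
      by (intro sum.cong) auto
    then show "(\<Sum>j\<in>UNIV. s j * (if j = j0 \<and> s j \<noteq> 0 then 1 else 0)) = lp_norm p s"
      by (simp add: j0)
  qed auto
next
  case real
  define P Q where "P = enn2real p" and "Q = enn2real q"
  have PQ: "1 < P" "1 < Q" "1 / P + 1 / Q = 1" using real by (simp_all add: P_def Q_def)
  have PQ': "(P - 1) * Q = P" using PQ by (simp add: field_simps)
  define N where "N = lp_norm p s"
  have N: "N = (\<Sum>j\<in>UNIV. s j powr P) powr (1 / P)"
    using real by (simp add: N_def lp_norm_def P_def)
  have "0 \<le> N" by (simp add: N)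
  have NP: "N powr P = (\<Sum>j\<in>UNIV. s j powr P)"
    using PQ by (simp add: N powr_powr sum_nonneg)
  \<comment> \<open>For \<open>N = 0\<close> division by zero makes this family vanish, as it should.\<close>
  show ?thesis
  proof (rule that[of "\<lambda>j. (s j / N) powr (P - 1)"])
    have "(\<Sum>j\<in>UNIV. ((s j / N) powr (P - 1)) powr Q) = (\<Sum>j\<in>UNIV. s j powr P) / N powr P"
      using s \<open>0 \<le> N\<close> by (simp add: powr_powr PQ' powr_divide sum_divide_distrib)
    also have "\<dots> \<le> 1" by (simp add: NP)
    finally have "(\<Sum>j\<in>UNIV. ((s j / N) powr (P - 1)) powr Q) powr (1 / Q) \<le> 1 powr (1 / Q)"
      using PQ by (intro powr_mono2) (auto simp: sum_nonneg)
    then show "lp_norm q (\<lambda>j. (s j / N) powr (P - 1)) \<le> 1"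
      using real by (simp add: lp_norm_def Q_def)
    have "s j * (s j / N) powr (P - 1) = s j powr P / N powr (P - 1)" for j
      using s[of j] \<open>0 \<le> N\<close> by (cases "s j = 0") (simp_all add: powr_divide powr_mult_base powr_diff)
    then have "(\<Sum>j\<in>UNIV. s j * (s j / N) powr (P - 1)) = N powr P / N powr (P - 1)"
      by (simp add: NP sum_divide_distrib)
    also have "\<dots> = N" using \<open>0 \<le> N\<close> by (cases "N = 0") (simp_all add: powr_diff)
    finally show "(\<Sum>j\<in>UNIV. s j * (s j / N) powr (P - 1)) = lp_norm p s" by (simp add: N_def)
  qed auto
qed

section \<open>Orthonormal bases and singular values\<close>

definition orthonormal :: "('c \<Rightarrow> real ^ 'c) \<Rightarrow> bool" where
  "orthonormal v \<longleftrightarrow> (\<forall>j k. v j \<bullet> v k = (if j = k then 1 else 0))"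

lemma orthonormal_Parseval:
  assumes "orthonormal v"
  shows "x \<bullet> y = (\<Sum>j\<in>UNIV. (x \<bullet> v j) * (y \<bullet> v j))"
proof -
  define R where "R = (\<chi> j. v j)"
  have "R ** transpose R = mat 1"
    using assms by (simp add: R_def matrix_matrix_mult_def transpose_def vec_eq_iff mat_def
        orthonormal_def inner_vec_def)
  then have "transpose R ** R = mat 1" by (simp add: matrix_left_right_inverse)
  then have "x = transpose R *v (R *v x)" by (simp add: matrix_vector_mul_assoc)
  then have "x \<bullet> y = (R *v x) \<bullet> (R *v y)"
    by (metis dot_lmul_matrix transpose_matrix_vector)
  then show ?thesis
    by (simp add: inner_vec_def[of "R *v x" for x] matrix_vector_mul_component) (simp add: R_def inner_commute)
qed

lemma orthonormal_expansion:
  assumes "orthonormal v"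
  shows "x = (\<Sum>j\<in>UNIV. (x \<bullet> v j) *\<^sub>R v j)"
proof (rule vector_eq_rdot[THEN iffD1], rule allI)
  fix z
  show "x \<bullet> z = (\<Sum>j\<in>UNIV. (x \<bullet> v j) *\<^sub>R v j) \<bullet> z"
    by (simp add: orthonormal_Parseval[OF assms, of x z] inner_sum_left inner_commute[of z])
qed

lemma inner_matrix_orthonormal:
  fixes X Y :: "real ^ 'c ^ 'r"
  assumes "orthonormal v"
  shows "X \<bullet> Y = (\<Sum>j\<in>UNIV. (X *v v j) \<bullet> (Y *v v j))"
proof -
  have "X \<bullet> Y = (\<Sum>r\<in>UNIV. X $ r \<bullet> Y $ r)" by (simp add: inner_vec_def)
  also have "\<dots> = (\<Sum>r\<in>UNIV. \<Sum>j\<in>UNIV. (X $ r \<bullet> v j) * (Y $ r \<bullet> v j))"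
    by (simp add: orthonormal_Parseval[OF assms, symmetric])
  also have "\<dots> = (\<Sum>j\<in>UNIV. \<Sum>r\<in>UNIV. (X $ r \<bullet> v j) * (Y $ r \<bullet> v j))"
    by (rule sum.swap)
  finally show ?thesis
    by (simp add: inner_vec_def[of "_ *v _"] matrix_vector_mul_component)
qed

lemma inner_matrix_two_orthonormal:
  fixes X Y :: "real ^ 'c ^ 'r"
  assumes "orthonormal v" "orthonormal w"
  shows "X \<bullet> Y = (\<Sum>j\<in>UNIV. \<Sum>k\<in>UNIV. (v j \<bullet> w k) * ((X *v v j) \<bullet> (Y *v w k)))"
proof -
  have "Y *v v j = (\<Sum>k\<in>UNIV. (v j \<bullet> w k) *\<^sub>R (Y *v w k))" for j
    by (subst orthonormal_expansion[OF assms(2), of "v j"])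
       (simp add: linear_sum[OF matrix_vector_mul_linear] linear_cmul[OF matrix_vector_mul_linear])
  then show ?thesis
    by (simp add: inner_matrix_orthonormal[OF assms(1)] inner_sum_right)
qed

text \<open>Vectors of norm below \<open>1\<close> are allowed, because a normalised image \<open>A *v v j\<close> may be zero.\<close>

lemma Bessel_inequality:
  fixes x :: "'k::finite \<Rightarrow> 'a::real_inner"
  assumes "\<And>k. norm (x k) \<le> 1" "\<And>j k. j \<noteq> k \<Longrightarrow> x j \<bullet> x k = 0"
  shows "(\<Sum>k\<in>UNIV. (u \<bullet> x k)\<^sup>2) \<le> (norm u)\<^sup>2"
proof -
  define y where "y = (\<Sum>k\<in>UNIV. (u \<bullet> x k) *\<^sub>R x k)"
  have uy: "u \<bullet> y = (\<Sum>k\<in>UNIV. (u \<bullet> x k)\<^sup>2)"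
    by (simp add: y_def inner_sum_right power2_eq_square)
  have "x j \<bullet> y = (u \<bullet> x j) * (norm (x j))\<^sup>2" for j
  proof -
    have "x j \<bullet> y = (\<Sum>k\<in>UNIV. if k = j then (u \<bullet> x j) * (norm (x j))\<^sup>2 else 0)"
      unfolding y_def inner_sum_right
      by (intro sum.cong) (auto simp: assms(2) power2_norm_eq_inner)
    then show ?thesis by simp
  qed
  then have "y \<bullet> y = (\<Sum>k\<in>UNIV. (u \<bullet> x k)\<^sup>2 * (norm (x k))\<^sup>2)"
    by (subst (1) y_def) (simp add: inner_sum_left power2_eq_square mult.assoc)
  also have "\<dots> \<le> u \<bullet> y"
    unfolding uy using assms(1) by (intro sum_mono mult_left_le) (auto simp: power_le_one)
  finally have "y \<bullet> y \<le> u \<bullet> y" .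
  moreover have "0 \<le> (u - y) \<bullet> (u - y)" by simp
  ultimately show ?thesis
    by (simp add: uy[symmetric] power2_norm_eq_inner inner_diff_left inner_diff_right inner_commute)
qed

text \<open>
  Right singular vectors.  The equivalent eigenvalue equation for \<open>A\<^sup>T A\<close> is
  \<open>svd_basis_eigenvector_iff\<close>.
\<close>

definition svd_basis :: "real ^ 'c ^ 'r \<Rightarrow> ('c \<Rightarrow> real ^ 'c) \<Rightarrow> bool" where
  "svd_basis A v \<longleftrightarrow> orthonormal v \<and> (\<forall>j k. j \<noteq> k \<longrightarrow> (A *v v j) \<bullet> (A *v v k) = 0)"

text \<open>
  Turning an orthonormal frame \<open>(v, w)\<close> by a right angle replaces it by \<open>(w, - v)\<close> and so reverses the
  sign of \<open>(A *v v) \<bullet> (A *v w)\<close>, which therefore vanishes at some angle in between.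
\<close>

lemma svd_basis_exists:
  fixes A :: "real ^ 2 ^ 'r"
  shows "\<exists>v. svd_basis A v"
proof -
  define v w :: "real \<Rightarrow> real ^ 2" where "v t = vector [cos t, sin t]" and "w t = vector [- sin t, cos t]" for t
  define \<phi> where "\<phi> t = (A *v v t) \<bullet> (A *v w t)" for t
  have rot: "\<phi> (pi / 2) = - \<phi> 0"
  proof -
    have "v (pi / 2) = w 0" "w (pi / 2) = - v 0" by (simp_all add: v_def w_def vec_eq_iff forall_2)
    then show ?thesis
      by (simp add: \<phi>_def inner_commute linear_neg[OF matrix_vector_mul_linear])
  qed
  have cont: "isCont \<phi> t" for t
  proof -
    have "\<phi> = (\<lambda>t. \<Sum>r\<in>UNIV. (A $ r $ 1 * cos t + A $ r $ 2 * sin t) * (- A $ r $ 1 * sin t + A $ r $ 2 * cos t))"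
      by (simp add: \<phi>_def fun_eq_iff inner_vec_def matrix_vector_mult_def v_def w_def sum_2)
    then show ?thesis by (simp add: continuous_intros)
  qed
  obtain t where t: "\<phi> t = 0"
  proof (cases "\<phi> 0 \<le> 0")
    case True
    then show ?thesis using IVT[of \<phi> 0 0 "pi / 2"] cont rot that by auto
  next
    case False
    then show ?thesis using IVT2[of \<phi> "pi / 2" 0 0] cont rot that by auto
  qed
  define u where "u j = (if j = 1 then v t else w t)" for j :: 2
  have "orthonormal u"
    by (simp add: orthonormal_def forall_2 u_def v_def w_def inner_vec_def sum_2 power2_eq_square[symmetric])
  moreover have "\<forall>j k. j \<noteq> k \<longrightarrow> (A *v u j) \<bullet> (A *v u k) = 0"
    using t by (simp add: forall_2 u_def \<phi>_def inner_commute)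
  ultimately show ?thesis unfolding svd_basis_def by blast
qed

text \<open>In the coordinates \<open>x \<bullet> v j\<close> the matrix \<open>A\<^sup>T A\<close> is diagonal with entries \<open>(norm (A *v v j))\<^sup>2\<close>.\<close>

lemma svd_basis_eigenvector_iff:
  assumes v: "svd_basis A v"
  shows "(transpose A ** A) *v x = c *\<^sub>R x \<longleftrightarrow> (\<forall>j. x \<bullet> v j = 0 \<or> (norm (A *v v j))\<^sup>2 = c)"
proof -
  have on: "orthonormal v" using v by (simp add: svd_basis_def)
  have "((transpose A ** A) *v x) \<bullet> v j = (norm (A *v v j))\<^sup>2 * (x \<bullet> v j)" for j
  proof -
    have "((transpose A ** A) *v x) \<bullet> v j = (A *v x) \<bullet> (A *v v j)"
      by (simp add: matrix_vector_mul_assoc[symmetric] dot_lmul_matrix)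
    also have "\<dots> = (\<Sum>k\<in>UNIV. (x \<bullet> v k) * ((A *v v k) \<bullet> (A *v v j)))"
      by (subst orthonormal_expansion[OF on, of x])
         (simp add: linear_sum[OF matrix_vector_mul_linear] linear_cmul[OF matrix_vector_mul_linear] inner_sum_left)
    also have "\<dots> = (\<Sum>k\<in>UNIV. if k = j then (x \<bullet> v j) * ((A *v v j) \<bullet> (A *v v j)) else 0)"
      using v by (intro sum.cong) (auto simp: svd_basis_def)
    finally show ?thesis by (simp add: power2_norm_eq_inner)
  qed
  moreover have "y = z \<longleftrightarrow> (\<forall>j. y \<bullet> v j = z \<bullet> v j)" for y z :: "real ^ 'a"
    using orthonormal_expansion[OF on, of y] orthonormal_expansion[OF on, of z] by auto
  ultimately show ?thesis by auto
qed

lemma singular_values_svd_basis: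
  assumes v: "svd_basis A v"
  shows "singular_values A = range (\<lambda>j. norm (A *v v j))"
proof -
  have on: "orthonormal v" using v by (simp add: svd_basis_def)
  have "\<sigma> \<in> range (\<lambda>j. norm (A *v v j))" if \<sigma>: "\<sigma> \<in> singular_values A" for \<sigma>
  proof -
    obtain x where x: "0 \<le> \<sigma>" "x \<noteq> 0" "(transpose A ** A) *v x = \<sigma>\<^sup>2 *\<^sub>R x"
      using \<sigma> by (auto simp: singular_values_def)
    \<comment> \<open>A nonzero vector has a nonzero coordinate; the eigenvalue there must be \<open>\<sigma>\<^sup>2\<close>.\<close>
    obtain j where "x \<bullet> v j \<noteq> 0"
      using orthonormal_Parseval[OF on, of x x] x(2) by force
    then have "(norm (A *v v j))\<^sup>2 = \<sigma>\<^sup>2" using x(3) by (auto simp: svd_basis_eigenvector_iff[OF v])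
    then show ?thesis using x(1) by (auto simp: power2_eq_iff_nonneg)
  qed
  moreover have "norm (A *v v j) \<in> singular_values A" for j
  proof -
    have "v j \<noteq> 0" using on unfolding orthonormal_def by (metis inner_zero_left zero_neq_one)
    moreover have "(transpose A ** A) *v v j = (norm (A *v v j))\<^sup>2 *\<^sub>R v j"
      using on by (auto simp: svd_basis_eigenvector_iff[OF v] orthonormal_def)
    ultimately show ?thesis by (auto simp: singular_values_def)
  qed
  ultimately show ?thesis by blast
qed

lemma sv_mult_svd_basis:
  assumes v: "svd_basis A v" and "0 \<le> \<sigma>"
  shows "sv_mult A \<sigma> = card {j. norm (A *v v j) = \<sigma>}"
proof -
  have on: "orthonormal v" using v by (simp add: svd_basis_def)
  have inj: "inj v" using on unfolding orthonormal_def by (metis injI zero_neq_one)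
  let ?E = "{x. (transpose A ** A) *v x = \<sigma>\<^sup>2 *\<^sub>R x}" and ?I = "{j. norm (A *v v j) = \<sigma>}"
  have iff: "x \<in> ?E \<longleftrightarrow> (\<forall>j. x \<bullet> v j = 0 \<or> j \<in> ?I)" for x
    using \<open>0 \<le> \<sigma>\<close> by (simp add: svd_basis_eigenvector_iff[OF v] power2_eq_iff_nonneg)
  have "?E = span (v ` ?I)"
  proof (intro equalityI subsetI)
    fix x assume "x \<in> ?E"
    then have "(x \<bullet> v j) *\<^sub>R v j \<in> span (v ` ?I)" for j
      using iff[of x] by (cases "x \<bullet> v j = 0") (auto intro!: span_mul[OF span_base] simp: span_zero)
    then have "(\<Sum>j\<in>UNIV. (x \<bullet> v j) *\<^sub>R v j) \<in> span (v ` ?I)" by (intro span_sum)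
    then show "x \<in> span (v ` ?I)" using orthonormal_expansion[OF on, of x] by simp
  next
    fix x assume "x \<in> span (v ` ?I)"
    moreover have "subspace ?E"
      by (simp add: subspace_def linear_add[OF matrix_vector_mul_linear]
          linear_cmul[OF matrix_vector_mul_linear] scaleR_right_distrib)
    moreover have "v j \<in> ?E" if "j \<in> ?I" for j
      by (subst iff) (use on that in \<open>auto simp: orthonormal_def\<close>)
    ultimately show "x \<in> ?E" using span_minimal[of "v ` ?I" ?E] by blast
  qed
  moreover have "independent (v ` ?I)"
    using on by (intro pairwise_orthogonal_independent)
      (auto simp: pairwise_def orthogonal_def orthonormal_def, metis inner_zero_left zero_neq_one)
  ultimately show ?thesis
    unfolding sv_mult_def
    by (simp add: dim_eq_card_independent card_image inj_on_subset[OF inj subset_UNIV])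
qed

lemma schatten_norm_svd_basis:
  assumes v: "svd_basis A v"
  shows "schatten_norm r A = lp_norm r (\<lambda>j. norm (A *v v j))"
proof -
  let ?s = "\<lambda>j. norm (A *v v j)"
  have "(\<Sum>\<sigma>\<in>singular_values A. real (sv_mult A \<sigma>) * \<sigma> powr e) = (\<Sum>j\<in>UNIV. ?s j powr e)" for e
  proof -
    have "(\<Sum>\<sigma>\<in>singular_values A. real (sv_mult A \<sigma>) * \<sigma> powr e) =
        (\<Sum>\<sigma>\<in>range ?s. \<Sum>j | j \<in> UNIV \<and> ?s j = \<sigma>. ?s j powr e)"
      unfolding singular_values_svd_basis[OF v]
      by (intro sum.cong) (auto simp: sv_mult_svd_basis[OF v])
    also have "\<dots> = (\<Sum>j\<in>UNIV. ?s j powr e)"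
      by (rule sum.image_gen[symmetric]) simp
    finally show ?thesis .
  qed
  then show ?thesis
    by (simp add: schatten_norm_def lp_norm_def singular_values_svd_basis[OF v])
qed

section \<open>Duality of Schatten norms\<close>

text \<open>
  Expanding \<open>X\<close> and \<open>Y\<close> in their singular bases gives the sum of
  \<open>s j * t k * (v j \<bullet> w k) * (x j \<bullet> y k)\<close> with left singular vectors \<open>x\<close> and \<open>y\<close>.  The product of the two
  cosines is at most the mean of their squares, which is doubly substochastic by Bessel's inequality.
\<close>

lemma schatten_Hoelder:
  fixes X Y :: "real ^ 2 ^ 'r"
  assumes pq: "1 / p + 1 / q = 1" and Y: "schatten_norm q Y \<le> 1"
  shows "X \<bullet> Y \<le> schatten_norm p X"
proof -
  obtain v w where vw: "svd_basis X v" "svd_basis Y w" using svd_basis_exists by metis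
  then have on: "orthonormal v" "orthonormal w" by (simp_all add: svd_basis_def)
  define s where "s j = norm (X *v v j)" for j
  define t where "t k = norm (Y *v w k)" for k
  \<comment> \<open>Left singular vectors; they are zero where the singular value is zero.\<close>
  define x where "x j = (1 / s j) *\<^sub>R (X *v v j)" for j
  define y where "y k = (1 / t k) *\<^sub>R (Y *v w k)" for k
  have sx: "X *v v j = s j *\<^sub>R x j" "norm (x j) \<le> 1" for j by (auto simp: x_def s_def)
  have ty: "Y *v w k = t k *\<^sub>R y k" "norm (y k) \<le> 1" for k by (auto simp: y_def t_def)
  have orth: "j \<noteq> k \<Longrightarrow> x j \<bullet> x k = 0" "j \<noteq> k \<Longrightarrow> y j \<bullet> y k = 0" for j k
    using vw by (simp_all add: x_def y_def svd_basis_def)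
  define W where "W j k = ((v j \<bullet> w k)\<^sup>2 + (x j \<bullet> y k)\<^sup>2) / 2" for j k
  have norm1: "norm (v j) = 1" "norm (w j) = 1" for j
    using on by (simp_all add: orthonormal_def norm_eq_1)
  have row: "(\<Sum>k\<in>UNIV. W j k) \<le> 1" for j
  proof -
    have "(\<Sum>k\<in>UNIV. (v j \<bullet> w k)\<^sup>2) \<le> (norm (v j))\<^sup>2"
      using on by (intro Bessel_inequality) (auto simp: norm1 orthonormal_def)
    moreover have "(\<Sum>k\<in>UNIV. (x j \<bullet> y k)\<^sup>2) \<le> (norm (x j))\<^sup>2"
      using ty orth by (intro Bessel_inequality)
    moreover have "(norm (x j))\<^sup>2 \<le> 1" using sx by (simp add: power_le_one)
    ultimately show ?thesis
      by (simp add: W_def sum.distrib sum_divide_distrib[symmetric] norm1)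
  qed
  have col: "(\<Sum>j\<in>UNIV. W j k) \<le> 1" for k
  proof -
    have "(\<Sum>j\<in>UNIV. (w k \<bullet> v j)\<^sup>2) \<le> (norm (w k))\<^sup>2"
      using on by (intro Bessel_inequality) (auto simp: norm1 orthonormal_def)
    moreover have "(\<Sum>j\<in>UNIV. (y k \<bullet> x j)\<^sup>2) \<le> (norm (y k))\<^sup>2"
      using sx orth by (intro Bessel_inequality)
    moreover have "(norm (y k))\<^sup>2 \<le> 1" using ty by (simp add: power_le_one)
    ultimately show ?thesis
      by (simp add: W_def sum.distrib sum_divide_distrib[symmetric] norm1 inner_commute)
  qed
  have "X \<bullet> Y = (\<Sum>j\<in>UNIV. \<Sum>k\<in>UNIV. (v j \<bullet> w k) * (x j \<bullet> y k) * (s j * t k))"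
    by (simp add: inner_matrix_two_orthonormal[OF on] sx(1) ty(1) ac_simps)
  also have "\<dots> \<le> (\<Sum>j\<in>UNIV. \<Sum>k\<in>UNIV. W j k * (s j * t k))"
  proof (intro sum_mono mult_right_mono)
    fix j k
    show "(v j \<bullet> w k) * (x j \<bullet> y k) \<le> W j k"
      using sum_squares_bound[of "v j \<bullet> w k" "x j \<bullet> y k"] by (simp add: W_def)
  qed (simp add: s_def t_def)
  also have "\<dots> \<le> lp_norm p s"
    using Y row col
    by (intro sum_mult_le_lp_norm[OF pq])
       (auto simp: s_def t_def[abs_def] W_def[abs_def] schatten_norm_svd_basis[OF vw(2)])
  finally show ?thesis by (simp add: s_def[abs_def] schatten_norm_svd_basis[OF vw(1)])
qed

text \<open>
  \<open>Y\<close> shares the singular vectors of \<open>X\<close>; its singular values are the extremal sequence of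
  \<open>lp_norm_attained\<close>.
\<close>

lemma schatten_norm_attained:
  fixes X :: "real ^ 2 ^ 'r"
  assumes pq: "1 / p + 1 / q = 1"
  shows "\<exists>Y. schatten_norm q Y \<le> 1 \<and> X \<bullet> Y = schatten_norm p X"
proof -
  obtain v where v: "svd_basis X v" using svd_basis_exists by metis
  then have on: "orthonormal v" by (simp add: svd_basis_def)
  define s where "s j = norm (X *v v j)" for j
  obtain c where c: "\<And>j. 0 \<le> c j" "\<And>j. s j = 0 \<Longrightarrow> c j = 0" "lp_norm q c \<le> 1"
      "(\<Sum>j\<in>UNIV. s j * c j) = lp_norm p s"
    using lp_norm_attained[OF pq, of s] by (auto simp: s_def)
  define x where "x j = (c j / s j) *\<^sub>R (X *v v j)" for j
  define Y :: "real ^ 2 ^ 'r" where "Y = matrix (\<lambda>z. \<Sum>j\<in>UNIV. (z \<bullet> v j) *\<^sub>R x j)"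
  have "Y *v v k = x k" for k
  proof -
    have "linear (\<lambda>z. \<Sum>j\<in>UNIV. (z \<bullet> v j) *\<^sub>R x j)"
      by (intro linearI) (simp_all add: inner_add_left algebra_simps sum.distrib scaleR_sum_right)
    then have "Y *v v k = (\<Sum>j\<in>UNIV. (v k \<bullet> v j) *\<^sub>R x j)" by (simp add: Y_def matrix_works)
    also have "\<dots> = (\<Sum>j\<in>UNIV. if j = k then x k else 0)"
      using on by (intro sum.cong) (auto simp: orthonormal_def)
    finally show ?thesis by simp
  qed
  note Yv = this
  have "svd_basis Y v" using v by (simp add: svd_basis_def Yv x_def)
  moreover have "norm (x j) = c j" for j using c(1,2)[of j] by (cases "s j = 0") (auto simp: x_def s_def)
  ultimately have "schatten_norm q Y = lp_norm q c" by (simp add: schatten_norm_svd_basis Yv)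
  moreover have "X \<bullet> Y = schatten_norm p X"
  proof -
    have "(X *v v j) \<bullet> x j = s j * c j" for j
      using c(2)[of j] by (cases "s j = 0") (auto simp: x_def s_def power2_norm_eq_inner[symmetric] power2_eq_square)
    then have "X \<bullet> Y = lp_norm p s"
      by (simp add: inner_matrix_orthonormal[OF on] Yv c(4))
    then show ?thesis by (simp add: schatten_norm_svd_basis[OF v] s_def[abs_def])
  qed
  ultimately show ?thesis using c(3) by (intro exI[of _ Y]) simp
qed

text \<open>
  The balls of conjugate Schatten norms are polar to each other; the converse direction uses
  attainment with \<open>p\<close> and \<open>q\<close> exchanged.
\<close>

lemma schatten_unit_ball_polar:
  fixes Y :: "real ^ 2 ^ 'r"
  assumes pq: "1 / p + 1 / q = 1"
  shows "schatten_norm q Y \<le> 1 \<longleftrightarrow> (\<forall>X. schatten_norm p X \<le> 1 \<longrightarrow> X \<bullet> Y \<le> 1)"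
proof
  show "schatten_norm q Y \<le> 1 \<Longrightarrow> \<forall>X. schatten_norm p X \<le> 1 \<longrightarrow> X \<bullet> Y \<le> 1"
    using schatten_Hoelder[OF pq] order_trans by blast
  have "1 / q + 1 / p = 1" using pq by (simp add: add.commute)
  then show "\<forall>X. schatten_norm p X \<le> 1 \<longrightarrow> X \<bullet> Y \<le> 1 \<Longrightarrow> schatten_norm q Y \<le> 1"
    using schatten_norm_attained[of q p Y] by (metis inner_commute)
qed

text \<open>
  By polarity, applied at each pixel, the ball is an intersection of closed half-spaces.  It is bounded
  because Hoelder's inequality, applied to a basis matrix and its negative, bounds every entry.
\<close>

lemma dual_ball_compact_convex:
  assumes pq: "1 / p + 1 / q = 1"
  shows "compact (dual_ball q :: (real ^ 2 ^ 'r ^ 'n) set)" "convex (dual_ball q :: (real ^ 2 ^ 'r ^ 'n) set)"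
proof -
  have eq: "(dual_ball q :: (real ^ 2 ^ 'r ^ 'n) set) =
      (\<Inter>n. \<Inter>X\<in>{X. schatten_norm p X \<le> 1}. {\<Phi>. axis n X \<bullet> \<Phi> \<le> 1})"
    by (auto simp: dual_ball_def schatten_unit_ball_polar[OF pq] inner_axis')
  show "convex (dual_ball q :: (real ^ 2 ^ 'r ^ 'n) set)"
    unfolding eq by (intro convex_INT convex_halfspace_le)
  have "closed (dual_ball q :: (real ^ 2 ^ 'r ^ 'n) set)"
    unfolding eq by (intro closed_INT ballI closed_halfspace_le)
  moreover have "bounded (dual_ball q :: (real ^ 2 ^ 'r ^ 'n) set)"
  proof -
    have "\<exists>M. \<forall>\<Phi>\<in>dual_ball q. \<bar>\<Phi> \<bullet> b\<bar> \<le> M" if Basis: "b \<in> Basis" for b :: "real ^ 2 ^ 'r ^ 'n"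
    proof -
      obtain n X where b: "b = axis n X" using Basis by (auto simp: Basis_vec_def)
      have "\<bar>\<Phi> \<bullet> b\<bar> \<le> max (schatten_norm p X) (schatten_norm p (- X))" if "\<Phi> \<in> dual_ball q" for \<Phi>
        using schatten_Hoelder[OF pq, of "\<Phi> $ n" X] schatten_Hoelder[OF pq, of "\<Phi> $ n" "- X"] that
        by (auto simp: b inner_axis dual_ball_def inner_commute[of X])
      then show ?thesis by blast
    qed
    then have "\<forall>b\<in>Basis. \<exists>M. \<forall>\<Phi>\<in>dual_ball q. \<bar>(\<Phi> :: real ^ 2 ^ 'r ^ 'n) \<bullet> b\<bar> \<le> M"
      by blast
    from bchoice[OF this] obtain M
      where M: "\<forall>b\<in>Basis. \<forall>\<Phi>\<in>dual_ball q. \<bar>(\<Phi> :: real ^ 2 ^ 'r ^ 'n) \<bullet> b\<bar> \<le> M b"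
      by blast
    let ?r = "\<Sum>b\<in>Basis. M b *\<^sub>R b :: real ^ 2 ^ 'r ^ 'n"
    have "dual_ball q \<subseteq> cbox (- ?r) ?r"
      using M by (force simp: mem_box inner_sum_left_Basis abs_le_iff)
    then show ?thesis by (rule bounded_subset[OF bounded_cbox])
  qed
  ultimately show "compact (dual_ball q :: (real ^ 2 ^ 'r ^ 'n) set)"
    by (simp add: compact_eq_bounded_closed)
qed

lemma dual_ball_inner_le:
  fixes \<Phi> X :: "real ^ 2 ^ 'r ^ 'n"
  assumes "1 / p + 1 / q = 1" "\<Phi> \<in> dual_ball q"
  shows "\<Phi> \<bullet> X \<le> (\<Sum>i\<in>UNIV. schatten_norm p (X $ i))"
proof -
  have "X $ i \<bullet> \<Phi> $ i \<le> schatten_norm p (X $ i)" for i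
    using assms by (intro schatten_Hoelder[OF assms(1)]) (simp add: dual_ball_def)
  then have "X \<bullet> \<Phi> \<le> (\<Sum>i\<in>UNIV. schatten_norm p (X $ i))"
    by (simp add: inner_vec_def[of X] sum_mono)
  then show ?thesis by (simp add: inner_commute)
qed

lemma dual_ball_inner_attained:
  fixes X :: "real ^ 2 ^ 'r ^ 'n"
  assumes "1 / p + 1 / q = 1"
  shows "\<exists>\<Phi>\<in>dual_ball q. \<Phi> \<bullet> X = (\<Sum>i\<in>UNIV. schatten_norm p (X $ i))"
proof -
  have "\<forall>i. \<exists>Y. schatten_norm q Y \<le> 1 \<and> X $ i \<bullet> Y = schatten_norm p (X $ i)"
    using schatten_norm_attained[OF assms] by blast
  from choice[OF this] obtain Y
    where Y: "\<forall>i. schatten_norm q (Y i) \<le> 1 \<and> X $ i \<bullet> Y i = schatten_norm p (X $ i)"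
    by blast
  have "X \<bullet> (\<chi> i. Y i) = (\<Sum>i\<in>UNIV. schatten_norm p (X $ i))"
    by (simp add: inner_vec_def[of X] Y)
  moreover have "(\<chi> i. Y i) \<in> dual_ball q"
    by (simp add: dual_ball_def Y)
  ultimately show ?thesis by (metis inner_commute)
qed

section \<open>Saddle points of strongly convex problems with a support function\<close>

text \<open>Completing the square in \<open>u\<close>.\<close>

lemma saddle_objective_eq:
  fixes J :: "'u::euclidean_space \<Rightarrow> 'x::euclidean_space"
  shows "saddle_objective \<tau> f J u \<Phi> =
     1 / 2 * (norm (u - (f - \<tau> *\<^sub>R adjoint J \<Phi>)))\<^sup>2
       + 1 / 2 * (norm f)\<^sup>2 - 1 / 2 * (norm (f - \<tau> *\<^sub>R adjoint J \<Phi>))\<^sup>2"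
proof -
  have "(norm (u - (f - v)))\<^sup>2 + (norm f)\<^sup>2 - (norm (f - v))\<^sup>2 = (norm (u - f))\<^sup>2 + 2 * (v \<bullet> u)" for v
    unfolding power2_norm_eq_inner
    by (simp add: inner_diff_left inner_diff_right inner_commute)
  from this[of "\<tau> *\<^sub>R adjoint J \<Phi>"] show ?thesis
    by (simp add: saddle_objective_def)
qed

text \<open>The assumptions on \<open>R\<close> say that it is the support function of \<open>B\<close> composed with \<open>J\<close>.\<close>

locale saddle_problem =
  fixes \<tau> :: real and f :: "'u::euclidean_space" and J :: "'u \<Rightarrow> 'x::euclidean_space"
    and C :: "'u set" and B :: "'x set" and R :: "'u \<Rightarrow> real"
  assumes \<tau>: "0 \<le> \<tau>" and J: "linear J"
    and C: "C \<noteq> {}" "closed C" "convex C"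
    and B: "B \<noteq> {}" "compact B" "convex B"
    and R_ge: "\<Phi> \<in> B \<Longrightarrow> \<Phi> \<bullet> J u \<le> R u"
    and R_attained: "\<exists>\<Phi>\<in>B. \<Phi> \<bullet> J u = R u"
begin

abbreviation H :: "'u \<Rightarrow> 'x \<Rightarrow> real" where "H \<equiv> saddle_objective \<tau> f J"

definition primal :: "'u \<Rightarrow> real" where "primal u = 1 / 2 * (norm (u - f))\<^sup>2 + \<tau> * R u"

definition center :: "'x \<Rightarrow> 'u" where "center \<Phi> = f - \<tau> *\<^sub>R adjoint J \<Phi>"

definition proj :: "'x \<Rightarrow> 'u" where "proj \<Phi> = closest_point C (center \<Phi>)"

definition dual :: "'x \<Rightarrow> real" where "dual \<Phi> = (INF u\<in>C. H u \<Phi>)"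

lemma H_eq: "H u \<Phi> = 1 / 2 * (norm (u - f))\<^sup>2 + \<tau> * (\<Phi> \<bullet> J u)"
  by (simp add: saddle_objective_def adjoint_clauses[OF J])

lemma H_eq_center: "H u \<Phi> = 1 / 2 * (norm (center \<Phi> - u))\<^sup>2 + 1 / 2 * (norm f)\<^sup>2 - 1 / 2 * (norm (center \<Phi>))\<^sup>2"
  by (simp add: saddle_objective_eq center_def norm_minus_commute)

lemma proj_in: "proj \<Phi> \<in> C"
  by (simp add: proj_def closest_point_in_set C)

lemma H_proj_le: "u \<in> C \<Longrightarrow> H (proj \<Phi>) \<Phi> \<le> H u \<Phi>"
  using closest_point_le[OF C(2), of u "center \<Phi>"]
  by (simp add: H_eq_center proj_def dist_norm power_mono)

lemma H_minimizer_unique: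
  assumes "u \<in> C" "H u \<Phi> \<le> H (proj \<Phi>) \<Phi>"
  shows "u = proj \<Phi>"
proof -
  have "norm (center \<Phi> - u) \<le> norm (center \<Phi> - proj \<Phi>)"
    by (rule power2_le_imp_le) (use assms(2) in \<open>simp_all add: H_eq_center\<close>)
  then have "\<forall>z\<in>C. dist (center \<Phi>) u \<le> dist (center \<Phi>) z"
    using closest_point_le[OF C(2), of _ "center \<Phi>"] order_trans by (force simp: proj_def dist_norm)
  then show ?thesis
    using closest_point_unique[OF C(3,2) assms(1)] by (simp add: proj_def)
qed

lemma dual_eq: "dual \<Phi> = H (proj \<Phi>) \<Phi>"
  unfolding dual_def by (rule cInf_eq_minimum) (use proj_in H_proj_le in auto)

lemma dual_le: "u \<in> C \<Longrightarrow> dual \<Phi> \<le> H u \<Phi>"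
  by (simp add: dual_eq H_proj_le)

lemma continuous_center: "continuous_on UNIV center"
  unfolding center_def
  by (intro continuous_intros linear_continuous_on linear_conv_bounded_linear[THEN iffD1] adjoint_linear J)

lemma continuous_proj: "continuous_on UNIV proj"
  unfolding proj_def
  by (rule continuous_on_compose2[OF continuous_on_closest_point[OF C(3,2,1)] continuous_center]) auto

lemma continuous_dual: "continuous_on UNIV dual"
  unfolding dual_eq H_eq_center by (intro continuous_intros continuous_center continuous_proj)

lemma dual_maximizer_exists: "\<exists>\<Phi>\<in>B. \<forall>\<Psi>\<in>B. dual \<Psi> \<le> dual \<Phi>"
  using continuous_attains_sup[OF B(2,1)] continuous_dual continuous_on_subset by blast

lemma H_segment: "H u ((1 - t) *\<^sub>R \<Phi> + t *\<^sub>R \<Psi>) = (1 - t) * H u \<Phi> + t * H u \<Psi>"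
  by (simp add: H_eq inner_add_left inner_diff_left field_simps)

text \<open>
  For \<open>t > 0\<close> let \<open>\<Phi>\<^sub>t\<close> be the point at parameter \<open>t\<close> of the segment from \<open>\<Phi>\<close> to \<open>\<Psi>\<close>, and \<open>u\<^sub>t\<close> its projection.
  Since \<open>H\<close> is affine in its second argument, \<open>dual \<Phi> \<ge> dual \<Phi>\<^sub>t = (1 - t) * H u\<^sub>t \<Phi> + t * H u\<^sub>t \<Psi>\<close>, and
  \<open>H u\<^sub>t \<Phi> \<ge> dual \<Phi>\<close>.  Cancelling leaves \<open>H u\<^sub>t \<Psi> \<le> dual \<Phi>\<close>, and \<open>t\<close> tends to \<open>0\<close>.
\<close>

lemma saddle_point:
  assumes \<Phi>: "\<Phi> \<in> B" and max: "\<And>\<Psi>. \<Psi> \<in> B \<Longrightarrow> dual \<Psi> \<le> dual \<Phi>" and \<Psi>: "\<Psi> \<in> B"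
  shows "H (proj \<Phi>) \<Psi> \<le> H (proj \<Phi>) \<Phi>"
proof -
  define \<Phi>t where "\<Phi>t t = (1 - t) *\<^sub>R \<Phi> + t *\<^sub>R \<Psi>" for t
  have le: "H (proj (\<Phi>t t)) \<Psi> \<le> dual \<Phi>" if t: "0 < t" "t \<le> 1" for t
  proof -
    have "\<Phi>t t \<in> B"
      unfolding \<Phi>t_def using t \<Phi> \<Psi> B(3) by (intro convexD) auto
    then have "(1 - t) * H (proj (\<Phi>t t)) \<Phi> + t * H (proj (\<Phi>t t)) \<Psi> \<le> dual \<Phi>"
      using max[of "\<Phi>t t"] unfolding dual_eq[of "\<Phi>t t"] by (simp add: \<Phi>t_def H_segment)
    moreover have "(1 - t) * dual \<Phi> \<le> (1 - t) * H (proj (\<Phi>t t)) \<Phi>"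
      using t by (intro mult_left_mono dual_le proj_in) auto
    ultimately have "t * H (proj (\<Phi>t t)) \<Psi> \<le> t * dual \<Phi>"
      by (simp add: algebra_simps)
    then show ?thesis using t by simp
  qed
  have "continuous_on UNIV (\<lambda>t. H (proj (\<Phi>t t)) \<Psi>)"
    unfolding H_eq_center \<Phi>t_def
    by (intro continuous_intros continuous_on_compose2[OF continuous_proj]) auto
  then have "((\<lambda>t. H (proj (\<Phi>t t)) \<Psi>) \<longlongrightarrow> H (proj (\<Phi>t 0)) \<Psi>) (at_right 0)"
    by (metis UNIV_I continuous_on_eq_continuous_within continuous_within filterlim_at_split)
  moreover have "eventually (\<lambda>t. H (proj (\<Phi>t t)) \<Psi> \<le> dual \<Phi>) (at_right 0)"
    unfolding eventually_at_right_field using le by (intro exI[of _ 1]) auto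
  ultimately have "H (proj (\<Phi>t 0)) \<Psi> \<le> dual \<Phi>"
    by (rule tendsto_upperbound) simp
  then show ?thesis by (simp add: \<Phi>t_def dual_eq)
qed

lemma H_le_primal: "\<Phi> \<in> B \<Longrightarrow> H u \<Phi> \<le> primal u"
  unfolding H_eq primal_def using \<tau> R_ge by (simp add: mult_left_mono)

lemma H_attains_primal: "\<exists>\<Phi>\<in>B. H u \<Phi> = primal u"
  unfolding H_eq primal_def using R_attained[of u] by force

lemma SUP_H: "(SUP \<Phi>\<in>B. H u \<Phi>) = primal u"
proof -
  obtain \<Phi> where "\<Phi> \<in> B" "H u \<Phi> = primal u" using H_attains_primal by blast
  then show ?thesis by (intro cSup_eq_maximum) (use H_le_primal in force)+
qed

lemma primal_proj:
  assumes "\<Phi> \<in> B" "\<And>\<Psi>. \<Psi> \<in> B \<Longrightarrow> dual \<Psi> \<le> dual \<Phi>"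
  shows "primal (proj \<Phi>) = H (proj \<Phi>) \<Phi>"
  using H_attains_primal[of "proj \<Phi>"] saddle_point[OF assms] H_le_primal[OF assms(1), of "proj \<Phi>"]
  by (metis order_antisym)

text \<open>
  For a dual maximiser \<open>\<Phi>\<close>, a primal minimiser \<open>u\<close> satisfies
  \<open>H u \<Phi> \<le> primal u = H (proj \<Phi>) \<Phi>\<close>, so it minimises \<open>H\<close> at \<open>\<Phi>\<close>, and that
  minimiser is unique.
\<close>

lemma primal_minimizer_iff:
  assumes "\<Phi> \<in> B" "\<And>\<Psi>. \<Psi> \<in> B \<Longrightarrow> dual \<Psi> \<le> dual \<Phi>"
  shows "is_arg_min primal (\<lambda>u. u \<in> C) u \<longleftrightarrow> u = proj \<Phi>"
proof -
  have primal_eq: "primal (proj \<Phi>) = H (proj \<Phi>) \<Phi>" using primal_proj assms by blast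
  have "primal (proj \<Phi>) \<le> primal u" if "u \<in> C" for u
    using that H_le_primal[OF assms(1), of u] H_proj_le[of u \<Phi>] by (simp add: primal_eq)
  moreover have "u = proj \<Phi>" if "u \<in> C" "primal u \<le> primal (proj \<Phi>)" for u
    using that H_le_primal[OF assms(1), of u] by (intro H_minimizer_unique) (auto simp: primal_eq)
  ultimately show ?thesis
    using proj_in by (auto simp: is_arg_min_linorder)
qed

theorem duality:
  "(\<exists>u. is_arg_min primal (\<lambda>u. u \<in> C) u) \<and>
   (\<forall>u\<in>C. \<exists>\<Phi>. is_arg_max (H u) (\<lambda>\<Phi>. \<Phi> \<in> B) \<Phi>) \<and>
   (\<exists>u. is_arg_min (\<lambda>u. SUP \<Phi>\<in>B. H u \<Phi>) (\<lambda>u. u \<in> C) u) \<and>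
   (\<forall>\<Phi>. \<exists>u. is_arg_min (\<lambda>u. H u \<Phi>) (\<lambda>u. u \<in> C) u) \<and>
   (\<exists>\<Phi>. is_arg_max dual (\<lambda>\<Phi>. \<Phi> \<in> B) \<Phi>) \<and>
   (\<forall>u\<in>C. primal u = (SUP \<Phi>\<in>B. H u \<Phi>)) \<and>
   (INF u\<in>C. primal u) = (INF u\<in>C. SUP \<Phi>\<in>B. H u \<Phi>) \<and>
   (\<exists>u'\<in>C. \<exists>\<Phi>'\<in>B.
      (\<forall>u\<in>C. \<forall>\<Phi>\<in>B. H u' \<Phi> \<le> H u' \<Phi>' \<and> H u' \<Phi>' \<le> H u \<Phi>') \<and>
      (INF u\<in>C. SUP \<Phi>\<in>B. H u \<Phi>) = H u' \<Phi>' \<and>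
      H u' \<Phi>' = (SUP \<Phi>\<in>B. INF u\<in>C. H u \<Phi>)) \<and>
   (\<forall>\<Phi>. let s = f - \<tau> *\<^sub>R adjoint J \<Phi> in
      dual \<Phi> = 1 / 2 * (norm (s - closest_point C s))\<^sup>2 + 1 / 2 * (norm f)\<^sup>2 - 1 / 2 * (norm s)\<^sup>2) \<and>
   (\<forall>\<Phi>'. is_arg_max dual (\<lambda>\<Phi>. \<Phi> \<in> B) \<Phi>' \<longrightarrow>
      (\<forall>u. is_arg_min primal (\<lambda>u. u \<in> C) u \<longleftrightarrow> u = closest_point C (f - \<tau> *\<^sub>R adjoint J \<Phi>')))"
proof -
  obtain \<Phi> where \<Phi>: "\<Phi> \<in> B" "\<And>\<Psi>. \<Psi> \<in> B \<Longrightarrow> dual \<Psi> \<le> dual \<Phi>"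
    using dual_maximizer_exists by blast
  have min: "is_arg_min primal (\<lambda>u. u \<in> C) (proj \<Phi>)"
    using primal_minimizer_iff[OF \<Phi>] by blast
  have INF_primal: "(INF u\<in>C. primal u) = primal (proj \<Phi>)"
    by (rule cInf_eq_minimum) (use min proj_in in \<open>auto simp: is_arg_min_linorder\<close>)
  have SUP_dual: "(SUP \<Phi>\<in>B. INF u\<in>C. H u \<Phi>) = dual \<Phi>"
    unfolding dual_def[symmetric] by (rule cSup_eq_maximum) (use \<Phi> in auto)
  have inner_max: "\<exists>\<Phi>. is_arg_max (H u) (\<lambda>\<Phi>. \<Phi> \<in> B) \<Phi>" for u
    using H_attains_primal[of u] H_le_primal[of _ u] by (force simp: is_arg_max_linorder)
  have inner_min: "\<exists>u. is_arg_min (\<lambda>u. H u \<Phi>) (\<lambda>u. u \<in> C) u" for \<Phi>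
    using proj_in[of \<Phi>] H_proj_le[of _ \<Phi>] by (auto simp: is_arg_min_linorder)
  have max: "is_arg_max dual (\<lambda>\<Phi>. \<Phi> \<in> B) \<Phi>"
    using \<Phi> by (simp add: is_arg_max_linorder)
  have saddle: "\<exists>u'\<in>C. \<exists>\<Phi>'\<in>B. (\<forall>u\<in>C. \<forall>\<Phi>\<in>B. H u' \<Phi> \<le> H u' \<Phi>' \<and> H u' \<Phi>' \<le> H u \<Phi>') \<and>
      (INF u\<in>C. primal u) = H u' \<Phi>' \<and> H u' \<Phi>' = (SUP \<Phi>\<in>B. INF u\<in>C. H u \<Phi>)"
  proof (intro bexI[of _ "proj \<Phi>"] bexI[of _ \<Phi>] conjI ballI)
    show "(INF u\<in>C. primal u) = H (proj \<Phi>) \<Phi>" using INF_primal primal_proj[OF \<Phi>] by simp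
    show "H (proj \<Phi>) \<Phi> = (SUP \<Phi>\<in>B. INF u\<in>C. H u \<Phi>)" using SUP_dual dual_eq by simp
  qed (use saddle_point[OF \<Phi>] H_proj_le proj_in \<Phi> in auto)
  have dual_min: "dual \<Phi> = 1 / 2 * (norm (center \<Phi> - closest_point C (center \<Phi>)))\<^sup>2
      + 1 / 2 * (norm f)\<^sup>2 - 1 / 2 * (norm (center \<Phi>))\<^sup>2" for \<Phi>
    by (simp add: dual_eq H_eq_center proj_def)
  have recover: "is_arg_min primal (\<lambda>u. u \<in> C) u \<longleftrightarrow> u = closest_point C (center \<Phi>')"
    if "is_arg_max dual (\<lambda>\<Phi>. \<Phi> \<in> B) \<Phi>'" for \<Phi>' u
    using primal_minimizer_iff[of \<Phi>' u] that by (auto simp: is_arg_max_linorder proj_def)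
  show ?thesis
    unfolding SUP_H Let_def center_def[symmetric]
  proof (intro conjI allI ballI impI refl)
    show "\<exists>u. is_arg_min primal (\<lambda>u. u \<in> C) u" using min by (rule exI)
    show "\<exists>u. is_arg_min primal (\<lambda>u. u \<in> C) u" using min by (rule exI)
    show "\<exists>\<Phi>. is_arg_max dual (\<lambda>\<Phi>. \<Phi> \<in> B) \<Phi>" using max by (rule exI)
  qed (rule inner_max inner_min saddle dual_min recover; assumption?)+
qed

end

section \<open>Duality for the weighted patch-based Jacobian\<close>

theorem mainTheorem2:
  fixes lo hi :: "int \<times> int"
    and px :: "'n::finite \<Rightarrow> int \<times> int"
    and f :: "real ^ 'n ^ 'm::finite"
    and bcG bc :: boundary
    and D :: "(int \<times> int) set"
    and \<sigma> \<kappa> sK \<tau> :: real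
    and LK :: nat
    and g :: "'l::finite \<Rightarrow> int \<times> int"
    and p q :: ennreal
    and C :: "(real ^ 'n ^ 'm) set"
    and J :: "real ^ 'n ^ 'm \<Rightarrow> real ^ 2 ^ ('m \<times> 'l) ^ 'n"
    and B :: "(real ^ 2 ^ ('m \<times> 'l) ^ 'n) set"
    and P :: "real ^ 'n ^ 'm \<Rightarrow> real"
    and H :: "real ^ 'n ^ 'm \<Rightarrow> real ^ 2 ^ ('m \<times> 'l) ^ 'n \<Rightarrow> real"
    and d :: "real ^ 2 ^ ('m \<times> 'l) ^ 'n \<Rightarrow> real"
  assumes grid: "bij_betw px UNIV (grid lo hi)"
    and D: "D = UNIV \<or> (\<exists>R. D = window R)"
    and \<sigma>: "\<sigma> > 0"
    and \<kappa>: "\<kappa> \<ge> 0"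
    and sK: "sK > 0"
    and g: "bij_betw g UNIV (window LK)"
    and J: "J = patch_jacobian bc (gauss_kernel (window LK) sK) g
                  (\<lambda>m. edge_weight_op bcG D \<sigma> \<kappa> lo hi px (f $ m)) lo hi px"
    and \<tau>: "\<tau> \<ge> 0"
    and p: "p \<ge> 1"
    and q: "1 / p + 1 / q = 1"
    and C: "C \<noteq> {}" "closed C" "convex C"
    and B: "B = dual_ball q"
    and P: "P = primal_objective p \<tau> f J"
    and H: "H = saddle_objective \<tau> f J"
    and d: "d = (\<lambda>\<Phi>. INF u\<in>C. H u \<Phi>)"
  shows
    "(\<exists>u. is_arg_min P (\<lambda>u. u \<in> C) u) \<and>
     (\<forall>u\<in>C. \<exists>\<Phi>. is_arg_max (H u) (\<lambda>\<Phi>. \<Phi> \<in> B) \<Phi>) \<and>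
     (\<exists>u. is_arg_min (\<lambda>u. SUP \<Phi>\<in>B. H u \<Phi>) (\<lambda>u. u \<in> C) u) \<and>
     (\<forall>\<Phi>. \<exists>u. is_arg_min (\<lambda>u. H u \<Phi>) (\<lambda>u. u \<in> C) u) \<and>
     (\<exists>\<Phi>. is_arg_max d (\<lambda>\<Phi>. \<Phi> \<in> B) \<Phi>) \<and>
     (\<forall>u\<in>C. P u = (SUP \<Phi>\<in>B. H u \<Phi>)) \<and>
     (INF u\<in>C. P u) = (INF u\<in>C. SUP \<Phi>\<in>B. H u \<Phi>) \<and>
     (\<exists>u'\<in>C. \<exists>\<Phi>'\<in>B.
        (\<forall>u\<in>C. \<forall>\<Phi>\<in>B. H u' \<Phi> \<le> H u' \<Phi>' \<and> H u' \<Phi>' \<le> H u \<Phi>') \<and>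
        (INF u\<in>C. SUP \<Phi>\<in>B. H u \<Phi>) = H u' \<Phi>' \<and>
        H u' \<Phi>' = (SUP \<Phi>\<in>B. INF u\<in>C. H u \<Phi>)) \<and>
     (\<forall>\<Phi>. let s = f - \<tau> *\<^sub>R adjoint J \<Phi> in
        d \<Phi> = 1 / 2 * (norm (s - closest_point C s))\<^sup>2 + 1 / 2 * (norm f)\<^sup>2 - 1 / 2 * (norm s)\<^sup>2) \<and>
     (\<forall>\<Phi>'. is_arg_max d (\<lambda>\<Phi>. \<Phi> \<in> B) \<Phi>' \<longrightarrow>
        (\<forall>u. is_arg_min P (\<lambda>u. u \<in> C) u \<longleftrightarrow> u = closest_point C (f - \<tau> *\<^sub>R adjoint J \<Phi>')))"
proof -
  have lin: "linear J" unfolding J by (intro linear_patch_jacobian linear_edge_weight_op)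
  have B_props: "B \<noteq> {}" "compact B" "convex B"
    using dual_ball_inner_attained[OF q] dual_ball_compact_convex[OF q] unfolding B by auto
  interpret saddle: saddle_problem \<tau> f J C B "\<lambda>u. \<Sum>i\<in>UNIV. schatten_norm p (J u $ i)"
    by (rule saddle_problem.intro)
       (use \<tau> C lin B_props dual_ball_inner_le[OF q] dual_ball_inner_attained[OF q] in \<open>simp_all add: B\<close>)
  have P_eq: "P = saddle.primal" by (simp add: P primal_objective_def saddle.primal_def fun_eq_iff)
  have d_eq: "d = saddle.dual" by (simp add: d H saddle.dual_def fun_eq_iff)
  show ?thesis unfolding P_eq d_eq H by (rule saddle.duality)
qed

end
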